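(* If $V$ is an indiscernible subspace in some Banach structure, then $V$ is isometric to a real Hilbert space. In particular, for a Banach structure $\mathfrak{M}$ and a set of parameters $A\subseteq\mathfrak{M}$, a real subspace $V$ of $\mathfrak{M}$ is indiscernible over $A$ if and only if $V$ is isometric to a real Hilbert space and, for every $n<\omega$ and every pair of $n$-tuples $\bar b,\bar c\in V$, $\bar b\equiv_A\bar c$ if and only if $\langle b_i,b_j\rangle=\langle c_i,c_j\rangle$ for all $i,j<n$, where $\langle\cdot,\cdot\rangle$ is the real inner product of $V$.
   Context: We work in continuous first-order logic. Let $K\in\{\mathbb{R},\mathbb{C}\}$. A $K$-Banach space $X$ is regarded as a metric structure whose universe is the closed unit ball $B(X)$, with metric $d(x,y)=\|x-y\|$, a predicate $\left\|\sum_i a_ix_i\right\|$ for each finite tuple $\bar a$ from $K$ (evaluated in $X$), a constant $\mathbf{0}$, and functions $\sigma_{\bar a}(\bar x)$ equal to $\sum_i a_ix_i$ if this lies in $B(X)$ and to $\sum_i a_ix_i/\|\sum_i a_ix_i\|$ otherwise. The space $X$ and the structure are conflated. A Banach structure is an expansion of such a structure. A real subspace of a Banach structure is a closed real linear subspace of the underlying Banach space; tuples from it to which types are applied are tuples from its unit ball. Two $n$-tuples $\bar b,\bar c$ are congruent, $\bar b\cong\bar c$, if $\|b_i-b_j\|=\|c_i-c_j\|$ for all $i,j\le n$, where $b_n=c_n=\mathbf{0}$. A real subspace $V$ of $\mathfrak{M}$ is an indiscernible subspace over $A\subseteq\mathfrak{M}$ if for every $n<\omega$ and all $n$-tuples $\bar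 b,\bar c\in V$, $\bar b\equiv_A\bar c$ (same type over $A$) if and only if $\bar b\cong\bar c$. An indiscernible subspace in a structure is one over some set of parameters. *)

theory Defs
  imports "HOL-Analysis.Analysis"
begin

section \<open>Scalars and Banach structures\<close>

text \<open>The scalar fields: a real normed field that is a copy of the real or of the complex numbers.
  Norms in \<^class>\<open>real_normed_field\<close> are multiplicative, so in both cases the norm is
  the usual absolute value.\<close>

class real_or_complex = real_normed_field +
  assumes real_or_complex:
    "(\<forall>z. \<exists>x. z = x *\<^sub>R 1) \<or>
     (\<exists>i. i * i = - 1 \<and> (\<forall>z. \<exists>x y. z = x *\<^sub>R 1 + y *\<^sub>R i))"

instance real :: real_or_complex
  by standard simp

instance complex :: real_or_complex
proof
  have "\<exists>x y. z = x *\<^sub>R 1 + y *\<^sub>R \<i>" for z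
    by (intro exI[of _ "Re z"] exI[of _ "Im z"]) (simp add: complex_eq_iff)
  then show "(\<forall>z::complex. \<exists>x. z = x *\<^sub>R 1) \<or>
      (\<exists>i::complex. i * i = - 1 \<and> (\<forall>z. \<exists>x y. z = x *\<^sub>R 1 + y *\<^sub>R i))"
    by (intro disjI2 exI[of _ "\<i>"]) auto
qed

text \<open>The Banach space over \<open>'k\<close> is the type \<open>'a\<close>, which carries the
  addition, the norm and the real scalar multiplication, together with the multiplication
  \<open>scal\<close> by scalars from \<open>'k\<close>.  The remaining fields are the symbols (with
  arities and interpretations) of the expansion; constant symbols are function symbols of arity 0.
  The universe of the structure is \<^term>\<open>cball 0 1 :: 'a::banach set\<close>, and only the
  values of the interpretations on tuples from it matter.\<close>

record ('k, 'a, 'f, 'p) banach_structure =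
  scal :: "'k \<Rightarrow> 'a \<Rightarrow> 'a"
  fun_syms :: "'f set"
  fun_arity :: "'f \<Rightarrow> nat"
  fun_int :: "'f \<Rightarrow> 'a list \<Rightarrow> 'a"
  pred_syms :: "'p set"
  pred_arity :: "'p \<Rightarrow> nat"
  pred_int :: "'p \<Rightarrow> 'a list \<Rightarrow> real"

definition tuples :: "nat \<Rightarrow> 'a set \<Rightarrow> 'a list set" where
  "tuples n S = {xs. length xs = n \<and> set xs \<subseteq> S}"

definition unif_cont_tuples ::
    "nat \<Rightarrow> 'a::metric_space set \<Rightarrow> ('a list \<Rightarrow> 'b::metric_space) \<Rightarrow> bool" where
  "unif_cont_tuples n S g \<longleftrightarrow>
     (\<forall>\<epsilon>>0. \<exists>\<delta>>0. \<forall>xs\<in>tuples n S. \<forall>ys\<in>tuples n S.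
        (\<forall>i<n. dist (xs ! i) (ys ! i) < \<delta>) \<longrightarrow> dist (g xs) (g ys) < \<epsilon>)"

text \<open>The bound on a predicate symbol and the moduli of uniform continuity are normally recorded in the
  signature; for a single structure it is enough that they exist.\<close>

locale is_banach_structure =
  fixes M :: "('k::real_or_complex, 'a::banach, 'f, 'p) banach_structure"
  assumes vector_space: "vector_space (scal M)"
    and scal_of_real: "scal M (of_real r) x = r *\<^sub>R x"
    and norm_scal: "norm (scal M a x) = norm a * norm x"
    and fun_closed: "\<lbrakk>f \<in> fun_syms M; xs \<in> tuples (fun_arity M f) (cball 0 1)\<rbrakk>
                       \<Longrightarrow> fun_int M f xs \<in> cball 0 1"
    and fun_unif_cont: "f \<in> fun_syms M \<Longrightarrow> unif_cont_tuples (fun_arity M f) (cball 0 1) (fun_int M f)"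
    and pred_bounded: "p \<in> pred_syms M \<Longrightarrow> bounded (pred_int M p ` tuples (pred_arity M p) (cball 0 1))"
    and pred_unif_cont: "p \<in> pred_syms M \<Longrightarrow> unif_cont_tuples (pred_arity M p) (cball 0 1) (pred_int M p)"

definition lincomb ::
    "('k, 'a::real_normed_vector, 'f, 'p) banach_structure \<Rightarrow> 'k list \<Rightarrow> 'a list \<Rightarrow> 'a" where
  "lincomb M as xs = (\<Sum>(a, x)\<leftarrow>zip as xs. scal M a x)"

definition sigma ::
    "('k, 'a::real_normed_vector, 'f, 'p) banach_structure \<Rightarrow> 'k list \<Rightarrow> 'a list \<Rightarrow> 'a" where
  "sigma M as xs =
     (let s = lincomb M as xs in if s \<in> cball 0 1 then s else s /\<^sub>R norm s)"


section \<open>Continuous first-order formulas and types\<close>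

text \<open>Terms and formulas with parameters.  A connective is a continuous function of finitely many
  reals, given as a continuous function on the product space \<^typ>\<open>nat \<Rightarrow> real\<close>
  that is applied to the finite tuple of values padded with zeros.\<close>

datatype ('k, 'a, 'f) trm =
    Var nat
  | Param 'a
  | Zero
  | Sigma "'k list" "('k, 'a, 'f) trm list"
  | Fn 'f "('k, 'a, 'f) trm list"

datatype ('k, 'a, 'f, 'p) fm =
    Dist "('k, 'a, 'f) trm" "('k, 'a, 'f) trm"
  | NormComb "'k list" "('k, 'a, 'f) trm list"
  | Pred 'p "('k, 'a, 'f) trm list"
  | Conn "(nat \<Rightarrow> real) \<Rightarrow> real" "('k, 'a, 'f, 'p) fm list"
  | FSup nat "('k, 'a, 'f, 'p) fm"
  | FInf nat "('k, 'a, 'f, 'p) fm"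

fun wf_trm :: "('k, 'a, 'f, 'p) banach_structure \<Rightarrow> 'a set \<Rightarrow> ('k, 'a, 'f) trm \<Rightarrow> bool" where
  "wf_trm M A (Var i) \<longleftrightarrow> True"
| "wf_trm M A (Param a) \<longleftrightarrow> a \<in> A"
| "wf_trm M A Zero \<longleftrightarrow> True"
| "wf_trm M A (Sigma as ts) \<longleftrightarrow> length as = length ts \<and> (\<forall>t\<in>set ts. wf_trm M A t)"
| "wf_trm M A (Fn f ts) \<longleftrightarrow>
     f \<in> fun_syms M \<and> length ts = fun_arity M f \<and> (\<forall>t\<in>set ts. wf_trm M A t)"

fun wf_fm :: "('k, 'a, 'f, 'p) banach_structure \<Rightarrow> 'a set \<Rightarrow> ('k, 'a, 'f, 'p) fm \<Rightarrow> bool" where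
  "wf_fm M A (Dist s t) \<longleftrightarrow> wf_trm M A s \<and> wf_trm M A t"
| "wf_fm M A (NormComb as ts) \<longleftrightarrow> length as = length ts \<and> (\<forall>t\<in>set ts. wf_trm M A t)"
| "wf_fm M A (Pred p ts) \<longleftrightarrow>
     p \<in> pred_syms M \<and> length ts = pred_arity M p \<and> (\<forall>t\<in>set ts. wf_trm M A t)"
| "wf_fm M A (Conn u \<phi>s) \<longleftrightarrow> continuous_on UNIV u \<and> (\<forall>\<phi>\<in>set \<phi>s. wf_fm M A \<phi>)"
| "wf_fm M A (FSup i \<phi>) \<longleftrightarrow> wf_fm M A \<phi>"
| "wf_fm M A (FInf i \<phi>) \<longleftrightarrow> wf_fm M A \<phi>"

fun vars_trm :: "('k, 'a, 'f) trm \<Rightarrow> nat set" where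
  "vars_trm (Var i) = {i}"
| "vars_trm (Param a) = {}"
| "vars_trm Zero = {}"
| "vars_trm (Sigma as ts) = (\<Union>t\<in>set ts. vars_trm t)"
| "vars_trm (Fn f ts) = (\<Union>t\<in>set ts. vars_trm t)"

fun free_vars :: "('k, 'a, 'f, 'p) fm \<Rightarrow> nat set" where
  "free_vars (Dist s t) = vars_trm s \<union> vars_trm t"
| "free_vars (NormComb as ts) = (\<Union>t\<in>set ts. vars_trm t)"
| "free_vars (Pred p ts) = (\<Union>t\<in>set ts. vars_trm t)"
| "free_vars (Conn u \<phi>s) = (\<Union>\<phi>\<in>set \<phi>s. free_vars \<phi>)"
| "free_vars (FSup i \<phi>) = free_vars \<phi> - {i}"
| "free_vars (FInf i \<phi>) = free_vars \<phi> - {i}"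

fun trm_val ::
    "('k, 'a::real_normed_vector, 'f, 'p) banach_structure \<Rightarrow> (nat \<Rightarrow> 'a) \<Rightarrow> ('k, 'a, 'f) trm \<Rightarrow> 'a" where
  "trm_val M e (Var i) = e i"
| "trm_val M e (Param a) = a"
| "trm_val M e Zero = 0"
| "trm_val M e (Sigma as ts) = sigma M as (map (trm_val M e) ts)"
| "trm_val M e (Fn f ts) = fun_int M f (map (trm_val M e) ts)"

fun fm_val ::
    "('k, 'a::real_normed_vector, 'f, 'p) banach_structure \<Rightarrow> (nat \<Rightarrow> 'a) \<Rightarrow> ('k, 'a, 'f, 'p) fm \<Rightarrow> real" where
  "fm_val M e (Dist s t) = norm (trm_val M e s - trm_val M e t)"
| "fm_val M e (NormComb as ts) = norm (lincomb M as (map (trm_val M e) ts))"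
| "fm_val M e (Pred p ts) = pred_int M p (map (trm_val M e) ts)"
| "fm_val M e (Conn u \<phi>s) =
     u (\<lambda>i. if i < length \<phi>s then map (fm_val M e) \<phi>s ! i else 0)"
| "fm_val M e (FSup i \<phi>) = (SUP a\<in>cball 0 1. fm_val M (e(i := a)) \<phi>)"
| "fm_val M e (FInf i \<phi>) = (INF a\<in>cball 0 1. fm_val M (e(i := a)) \<phi>)"

text \<open>The variable with index \<open>i\<close> stands for the \<open>i\<close>-th entry of the tuple;
  the value beyond the length of the tuple is irrelevant.\<close>

definition assignment :: "'a::zero list \<Rightarrow> nat \<Rightarrow> 'a" where
  "assignment b i = (if i < length b then b ! i else 0)"

definition same_type ::
    "('k, 'a::real_normed_vector, 'f, 'p) banach_structure \<Rightarrow> 'a set \<Rightarrow> nat \<Rightarrow> 'a list \<Rightarrow> 'a list \<Rightarrow> bool" where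
  "same_type M A n b c \<longleftrightarrow>
     (\<forall>\<phi>. wf_fm M A \<phi> \<and> free_vars \<phi> \<subseteq> {..<n} \<longrightarrow>
          fm_val M (assignment b) \<phi> = fm_val M (assignment c) \<phi>)"


section \<open>Indiscernible subspaces\<close>

definition congruent_tuples :: "nat \<Rightarrow> 'a::real_normed_vector list \<Rightarrow> 'a list \<Rightarrow> bool" where
  "congruent_tuples n b c \<longleftrightarrow>
     (\<forall>i\<le>n. \<forall>j\<le>n. norm ((b @ [0]) ! i - (b @ [0]) ! j) = norm ((c @ [0]) ! i - (c @ [0]) ! j))"

definition real_subspace :: "'a::real_normed_vector set \<Rightarrow> bool" where
  "real_subspace V \<longleftrightarrow> subspace V \<and> closed V"

definition indiscernible_subspace_over ::
    "('k, 'a::real_normed_vector, 'f, 'p) banach_structure \<Rightarrow> 'a set \<Rightarrow> 'a set \<Rightarrow> bool" where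
  "indiscernible_subspace_over M A V \<longleftrightarrow>
     real_subspace V \<and>
     (\<forall>n. \<forall>b\<in>tuples n (V \<inter> cball 0 1). \<forall>c\<in>tuples n (V \<inter> cball 0 1).
        same_type M A n b c \<longleftrightarrow> congruent_tuples n b c)"

definition indiscernible_subspace ::
    "('k, 'a::real_normed_vector, 'f, 'p) banach_structure \<Rightarrow> 'a set \<Rightarrow> bool" where
  "indiscernible_subspace M V \<longleftrightarrow> (\<exists>A\<subseteq>cball 0 1. indiscernible_subspace_over M A V)"


section \<open>Real Hilbert spaces\<close>

text \<open>Hilbert spaces have explicit carriers and operations, because a type cannot be quantified
  existentially.\<close>

record 'h hilbert_data =
  hcarrier :: "'h set"
  hzero :: 'h
  hadd :: "'h \<Rightarrow> 'h \<Rightarrow> 'h"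
  hscale :: "real \<Rightarrow> 'h \<Rightarrow> 'h"
  hinner :: "'h \<Rightarrow> 'h \<Rightarrow> real"

definition hnorm :: "'h hilbert_data \<Rightarrow> 'h \<Rightarrow> real" where
  "hnorm H x = sqrt (hinner H x x)"

definition hdist :: "'h hilbert_data \<Rightarrow> 'h \<Rightarrow> 'h \<Rightarrow> real" where
  "hdist H x y = hnorm H (hadd H x (hscale H (- 1) y))"

locale real_hilbert_space =
  fixes H :: "'h hilbert_data"
  assumes zero_closed: "hzero H \<in> hcarrier H"
    and add_closed: "\<lbrakk>x \<in> hcarrier H; y \<in> hcarrier H\<rbrakk> \<Longrightarrow> hadd H x y \<in> hcarrier H"
    and scale_closed: "x \<in> hcarrier H \<Longrightarrow> hscale H r x \<in> hcarrier H"
    and add_assoc: "\<lbrakk>x \<in> hcarrier H; y \<in> hcarrier H; z \<in> hcarrier H\<rbrakk>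
                      \<Longrightarrow> hadd H (hadd H x y) z = hadd H x (hadd H y z)"
    and add_commute: "\<lbrakk>x \<in> hcarrier H; y \<in> hcarrier H\<rbrakk> \<Longrightarrow> hadd H x y = hadd H y x"
    and add_zero: "x \<in> hcarrier H \<Longrightarrow> hadd H x (hzero H) = x"
    and add_inverse: "x \<in> hcarrier H \<Longrightarrow> hadd H x (hscale H (- 1) x) = hzero H"
    and scale_add_right: "\<lbrakk>x \<in> hcarrier H; y \<in> hcarrier H\<rbrakk>
                      \<Longrightarrow> hscale H r (hadd H x y) = hadd H (hscale H r x) (hscale H r y)"
    and scale_add_left: "x \<in> hcarrier H \<Longrightarrow> hscale H (r + s) x = hadd H (hscale H r x) (hscale H s x)"
    and scale_scale: "x \<in> hcarrier H \<Longrightarrow> hscale H r (hscale H s x) = hscale H (r * s) x"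
    and scale_one: "x \<in> hcarrier H \<Longrightarrow> hscale H 1 x = x"
    and inner_commute: "\<lbrakk>x \<in> hcarrier H; y \<in> hcarrier H\<rbrakk> \<Longrightarrow> hinner H x y = hinner H y x"
    and inner_add_left: "\<lbrakk>x \<in> hcarrier H; y \<in> hcarrier H; z \<in> hcarrier H\<rbrakk>
                      \<Longrightarrow> hinner H (hadd H x y) z = hinner H x z + hinner H y z"
    and inner_scale_left: "\<lbrakk>x \<in> hcarrier H; y \<in> hcarrier H\<rbrakk>
                      \<Longrightarrow> hinner H (hscale H r x) y = r * hinner H x y"
    and inner_nonneg: "x \<in> hcarrier H \<Longrightarrow> 0 \<le> hinner H x x"
    and inner_eq_zero: "\<lbrakk>x \<in> hcarrier H; hinner H x x = 0\<rbrakk> \<Longrightarrow> x = hzero H"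
    and complete: "\<lbrakk>\<And>n. X n \<in> hcarrier H;
                    \<forall>\<epsilon>>0. \<exists>N. \<forall>m\<ge>N. \<forall>n\<ge>N. hdist H (X m) (X n) < \<epsilon>\<rbrakk>
                      \<Longrightarrow> \<exists>l\<in>hcarrier H. (\<lambda>n. hdist H (X n) l) \<longlonglongrightarrow> 0"

definition linear_isometry_onto ::
    "('a::real_normed_vector \<Rightarrow> 'h) \<Rightarrow> 'a set \<Rightarrow> 'h hilbert_data \<Rightarrow> bool" where
  "linear_isometry_onto f V H \<longleftrightarrow>
     bij_betw f V (hcarrier H) \<and>
     (\<forall>x\<in>V. \<forall>y\<in>V. f (x + y) = hadd H (f x) (f y)) \<and>
     (\<forall>r. \<forall>x\<in>V. f (r *\<^sub>R x) = hscale H r (f x)) \<and>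
     (\<forall>x\<in>V. hnorm H (f x) = norm x)"

text \<open>A Hilbert space isometric to \<open>V\<close> is in bijection with \<open>V\<close>, so it is no
  restriction to take its elements from the type of \<open>V\<close>.\<close>

definition isometric_to_real_hilbert_space :: "'a::real_normed_vector set \<Rightarrow> bool" where
  "isometric_to_real_hilbert_space V \<longleftrightarrow>
     (\<exists>(H :: 'a hilbert_data) f. real_hilbert_space H \<and> linear_isometry_onto f V H)"

text \<open>The inner product of \<open>V\<close> is the one pulled back along an isometry onto a Hilbert space;
  by polarization it depends neither on the isometry nor on the Hilbert space.\<close>

definition real_inner_of :: "'a::real_normed_vector set \<Rightarrow> 'a \<Rightarrow> 'a \<Rightarrow> real" where
  "real_inner_of V x y =
     (THE r. \<exists>(H :: 'a hilbert_data) f.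
        real_hilbert_space H \<and> linear_isometry_onto f V H \<and> r = hinner H (f x) (f y))"

lemma real_inner_of_eq:
  fixes V :: "'a::real_normed_vector set" and H :: "'a hilbert_data"
  assumes V: "subspace V" and H: "real_hilbert_space H" and f: "linear_isometry_onto f V H"
    and x: "x \<in> V" and y: "y \<in> V"
  shows "real_inner_of V x y = hinner H (f x) (f y)"
proof -
  have polar: "hinner H' (g x) (g y) = ((norm (x + y))\<^sup>2 - (norm x)\<^sup>2 - (norm y)\<^sup>2) / 2"
    if H': "real_hilbert_space H'" and g: "linear_isometry_onto g V H'"
    for H' :: "'a hilbert_data" and g
  proof -
    interpret real_hilbert_space H' by (fact H')
    have mem: "g v \<in> hcarrier H'" if "v \<in> V" for v
      using g that by (auto simp: linear_isometry_onto_def bij_betw_def)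
    have sq: "(norm v)\<^sup>2 = hinner H' (g v) (g v)" if "v \<in> V" for v
    proof -
      have "norm v = sqrt (hinner H' (g v) (g v))"
        using g that by (simp add: linear_isometry_onto_def hnorm_def)
      then show ?thesis using inner_nonneg[OF mem[OF that]] by simp
    qed
    have xy: "x + y \<in> V" using V x y by (rule subspace_add)
    have "g (x + y) = hadd H' (g x) (g y)"
      using g x y by (simp add: linear_isometry_onto_def)
    then have "hinner H' (g (x + y)) (g (x + y))
        = hinner H' (g x) (g (x + y)) + hinner H' (g y) (g (x + y))"
      using inner_add_left[OF mem[OF x] mem[OF y] mem[OF xy]] by simp
    also have "\<dots> = hinner H' (g (x + y)) (g x) + hinner H' (g (x + y)) (g y)"
      using inner_commute mem x y xy by simp
    also have "\<dots> = hinner H' (g x) (g x) + hinner H' (g y) (g x)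
        + (hinner H' (g x) (g y) + hinner H' (g y) (g y))"
      using \<open>g (x + y) = _\<close> inner_add_left mem x y by simp
    also have "hinner H' (g y) (g x) = hinner H' (g x) (g y)"
      using inner_commute mem x y by simp
    finally show ?thesis using sq[OF x] sq[OF y] sq[OF xy] by simp
  qed
  show ?thesis
    unfolding real_inner_of_def
  proof (rule the_equality)
    show "\<exists>(H' :: 'a hilbert_data) g. real_hilbert_space H' \<and> linear_isometry_onto g V H' \<and>
        hinner H (f x) (f y) = hinner H' (g x) (g y)"
      using H f by blast
  next
    fix r
    assume "\<exists>(H' :: 'a hilbert_data) g. real_hilbert_space H' \<and> linear_isometry_onto g V H' \<and>
        r = hinner H' (g x) (g y)"
    then obtain H' :: "'a hilbert_data" and g
      where "real_hilbert_space H'" "linear_isometry_onto g V H'" "r = hinner H' (g x) (g y)"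
      by blast
    then show "r = hinner H (f x) (f y)"
      using polar[of H' g] polar[OF H f] by linarith
  qed
qed

end

theory Submission
  imports Defs
begin

text \<open>Congruent pairs have the same type, hence in \<open>V\<close> the norm of every real linear
  combination of two vectors \<open>a, b\<close> depends only on the norms of \<open>a\<close>, \<open>b\<close> and
  \<open>a - b\<close>.  In a plane spanned by unit vectors \<open>p, q\<close> with \<open>\<parallel>p + q\<parallel> = \<parallel>p - q\<parallel>\<close>,
  identified with the complex numbers by \<open>p = 1\<close> and \<open>q = \<i>\<close>, it follows that the norm
  \<open>N\<close> is invariant under conjugation and under multiplication by \<open>\<i>\<close>; the pairs
  \<open>(u, \<i>u)\<close> and \<open>(u, -\<i>u)\<close> are therefore congruent, which gives
  \<open>N (w u) = N (cnj w u)\<close> for all \<open>w\<close> and \<open>u\<close>.  Taking \<open>u = w\<close> yields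
  \<open>N (w\<^sup>2) = \<bar>w\<bar>\<^sup>2\<close>, and since every complex number is a square, the plane is Euclidean.
  The Jordan-von Neumann argument then makes \<open>V\<close> a Hilbert space, and there congruence of
  tuples is equality of Gram matrices.\<close>

section \<open>The Euclidean norm on planes\<close>

locale pair_rigid_subspace =
  fixes V :: "'a::real_normed_vector set"
  assumes subspace: "subspace V"
    and norm_combination_eq:
      "\<lbrakk>a \<in> V; b \<in> V; c \<in> V; d \<in> V; norm a = norm c; norm b = norm d; norm (a - b) = norm (c - d)\<rbrakk>
        \<Longrightarrow> norm (l *\<^sub>R a + m *\<^sub>R b) = norm (l *\<^sub>R c + m *\<^sub>R d)"
begin

lemmas mem_simps = subspace_add[OF subspace] subspace_diff[OF subspace] subspace_scale[OF subspace]
  subspace_neg[OF subspace] subspace_0[OF subspace]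

lemma norm_swap:
  assumes "p \<in> V" "q \<in> V" "norm p = norm q"
  shows "norm (l *\<^sub>R p + m *\<^sub>R q) = norm (l *\<^sub>R q + m *\<^sub>R p)"
  by (rule norm_combination_eq) (simp_all add: assms norm_minus_commute)

text \<open>The hypothesis is what makes \<open>(p, q)\<close> and \<open>(p, - q)\<close>
  congruent; with \<open>p = 1\<close> and \<open>q = \<i>\<close> this is conjugation.\<close>

lemma norm_reflect:
  assumes "p \<in> V" "q \<in> V" "norm (p + q) = norm (p - q)"
  shows "norm (l *\<^sub>R p + m *\<^sub>R q) = norm (l *\<^sub>R p - m *\<^sub>R q)"
  using norm_combination_eq[of p q p "- q" l m] assms by (simp add: mem_simps)

lemma norm_orthonormal:
  assumes p: "p \<in> V" "norm p = 1" and q: "q \<in> V" "norm q = 1"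
    and orth: "norm (p + q) = norm (p - q)"
  shows "(norm (\<alpha> *\<^sub>R p + \<beta> *\<^sub>R q))\<^sup>2 = \<alpha>\<^sup>2 + \<beta>\<^sup>2"
proof -
  \<comment> \<open>Under \<open>p = 1\<close>, \<open>q = \<i>\<close>, the vectors
    \<open>u\<close> and \<open>v\<close> below are \<open>w\<close> and \<open>\<i> * w\<close>, so
    \<open>s *\<^sub>R u + t *\<^sub>R v\<close> is \<open>w * w\<close>, the target vector, and
    \<open>s *\<^sub>R u - t *\<^sub>R v\<close> is \<open>cnj w * w\<close>.\<close>
  define w where "w = csqrt (Complex \<alpha> \<beta>)"
  define s where "s = Re w"
  define t where "t = Im w"
  have "w\<^sup>2 = Complex \<alpha> \<beta>" by (simp add: w_def)
  then have \<alpha>: "\<alpha> = s\<^sup>2 - t\<^sup>2" and \<beta>: "\<beta> = 2 * s * t"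
    by (simp_all add: s_def t_def complex_eq_iff Re_power2 Im_power2)
  define u where "u = s *\<^sub>R p + t *\<^sub>R q"
  define v where "v = s *\<^sub>R q - t *\<^sub>R p"
  have uv: "u \<in> V" "v \<in> V" using p q by (auto simp: u_def v_def mem_simps)
  \<comment> \<open>Multiplication by \<open>\<i>\<close> is the swap followed by a reflection, up
    to a sign.\<close>
  have rot: "norm (a *\<^sub>R p + b *\<^sub>R q) = norm (a *\<^sub>R q - b *\<^sub>R p)" for a b
  proof -
    have "norm (a *\<^sub>R p + b *\<^sub>R q) = norm (b *\<^sub>R p + a *\<^sub>R q)"
      using norm_swap[of p q a b] p q by (simp add: add.commute)
    also have "\<dots> = norm (b *\<^sub>R p - a *\<^sub>R q)"
      by (rule norm_reflect[OF p(1) q(1) orth])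
    finally show ?thesis by (simp add: norm_minus_commute)
  qed
  \<comment> \<open>Here \<open>u + v\<close> is \<open>\<i>\<close> times \<open>u - v\<close>, so
    \<open>rot\<close> gives the hypothesis of \<open>norm_reflect\<close> for \<open>u\<close> and
    \<open>v\<close>.\<close>
  have "u - v = (s + t) *\<^sub>R p + (t - s) *\<^sub>R q" and "u + v = (s + t) *\<^sub>R q - (t - s) *\<^sub>R p"
    by (simp_all add: u_def v_def algebra_simps)
  then have "norm (u + v) = norm (u - v)" using rot by metis
  then have "norm (s *\<^sub>R u + t *\<^sub>R v) = norm (s *\<^sub>R u - t *\<^sub>R v)"
    by (rule norm_reflect[OF uv])
  also have "s *\<^sub>R u + t *\<^sub>R v = \<alpha> *\<^sub>R p + \<beta> *\<^sub>R q"
    by (simp add: u_def v_def \<alpha> \<beta> algebra_simps power2_eq_square flip: scaleR_add_left)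
  also have "s *\<^sub>R u - t *\<^sub>R v = (s\<^sup>2 + t\<^sup>2) *\<^sub>R p"
    by (simp add: u_def v_def algebra_simps power2_eq_square)
  finally have "norm (\<alpha> *\<^sub>R p + \<beta> *\<^sub>R q) = s\<^sup>2 + t\<^sup>2" using p by simp
  then show ?thesis by (simp add: \<alpha> \<beta> power2_eq_square algebra_simps)
qed

text \<open>An intermediate value argument: along a path on the unit sphere of the plane from
  \<open>x\<close> to \<open>- x\<close>, the difference of the two norms to be equated goes from 2
  to -2.\<close>

lemma orthonormal_complement:
  assumes x: "x \<in> V" "norm x = 1" and y: "y \<in> V" and indep: "\<And>c. y \<noteq> c *\<^sub>R x"
  obtains q \<alpha> \<beta> where "q \<in> V" "norm q = 1" "norm (x + q) = norm (x - q)"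
    "y = \<alpha> *\<^sub>R x + \<beta> *\<^sub>R q"
proof -
  \<comment> \<open>Independence keeps this half-turn away from 0, so it can be normalized to
    \<open>c\<close>.\<close>
  define h where "h \<theta> = cos \<theta> *\<^sub>R x + sin \<theta> *\<^sub>R y" for \<theta>
  have h_nz: "h \<theta> \<noteq> 0" for \<theta>
  proof
    assume 0: "h \<theta> = 0"
    show False
    proof (cases "sin \<theta> = 0")
      case True
      then have "cos \<theta> \<noteq> 0" using sin_cos_squared_add[of \<theta>] by force
      then show False using 0 True x by (auto simp: h_def)
    next
      case False
      have "sin \<theta> *\<^sub>R y = (- cos \<theta>) *\<^sub>R x"
        using 0 by (simp add: h_def add_eq_0_iff)
      then have "y = inverse (sin \<theta>) *\<^sub>R ((- cos \<theta>) *\<^sub>R x)"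
        using False by (metis left_inverse scaleR_one scaleR_scaleR)
      then have "y = (inverse (sin \<theta>) * (- cos \<theta>)) *\<^sub>R x" by (simp only: scaleR_scaleR)
      then show False using indep by blast
    qed
  qed
  define c where "c \<theta> = h \<theta> /\<^sub>R norm (h \<theta>)" for \<theta>
  define g where "g \<theta> = norm (x + c \<theta>) - norm (x - c \<theta>)" for \<theta>
  have "continuous_on {0..pi} g"
    unfolding g_def c_def using h_nz by (auto simp: h_def intro!: continuous_intros)
  moreover have "c 0 = x" "c pi = - x" using x by (auto simp: c_def h_def)
  then have "g 0 = 2" "g pi = -2"
    using x by (simp_all add: g_def flip: scaleR_2)
  ultimately obtain \<theta> where \<theta>: "g \<theta> = 0"
    using IVT2'[of g pi 0 0] by auto
  define q where "q = c \<theta>"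
  have q: "q \<in> V" "norm q = 1" "norm (x + q) = norm (x - q)"
    using \<theta> h_nz x y by (auto simp: q_def g_def c_def h_def mem_simps)
  \<comment> \<open>Otherwise \<open>q\<close> is \<open>x\<close> or \<open>- x\<close>, and the
    norms of \<open>x + q\<close> and \<open>x - q\<close> are 0 and 2 in some order. Hence
    \<open>y\<close> really occurs in \<open>q\<close> and can be solved for.\<close>
  have "sin \<theta> \<noteq> 0"
  proof
    assume s: "sin \<theta> = 0"
    then have "cos \<theta> = 1 \<or> cos \<theta> = - 1"
      using sin_cos_squared_add[of \<theta>] by (simp add: power2_eq_1_iff)
    then have "q = x \<or> q = - x" using s x by (auto simp: q_def c_def h_def)
    then show False using q(3) x by (auto simp flip: scaleR_2)
  qed
  moreover have "norm (h \<theta>) *\<^sub>R q = cos \<theta> *\<^sub>R x + sin \<theta> *\<^sub>R y"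
    using h_nz by (simp add: q_def c_def flip: h_def)
  then have "sin \<theta> *\<^sub>R y = norm (h \<theta>) *\<^sub>R q - cos \<theta> *\<^sub>R x" by simp
  ultimately have "y = inverse (sin \<theta>) *\<^sub>R (norm (h \<theta>) *\<^sub>R q - cos \<theta> *\<^sub>R x)"
    by (metis left_inverse scaleR_one scaleR_scaleR)
  then have "y = (- inverse (sin \<theta>) * cos \<theta>) *\<^sub>R x + (inverse (sin \<theta>) * norm (h \<theta>)) *\<^sub>R q"
    by (simp add: scaleR_diff_right)
  then show thesis using that q by blast
qed

text \<open>For independent vectors the form is read off in an orthonormal basis starting with
  \<open>x\<close> normalized. The coefficient \<open>k\<close> stays anonymous; setting
  \<open>s = t = 1\<close> later identifies it as \<open>polar x y\<close>.\<close>

lemma norm_quadratic: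
  assumes x: "x \<in> V" and y: "y \<in> V"
  obtains k where "\<And>s t. (norm (s *\<^sub>R x + t *\<^sub>R y))\<^sup>2 = s\<^sup>2 * (norm x)\<^sup>2 + 2 * s * t * k + t\<^sup>2 * (norm y)\<^sup>2"
proof (cases "x = 0")
  case True
  show thesis by (rule that[of 0]) (simp add: True power_mult_distrib)
next
  case nz: False
  show thesis
  proof (cases "\<exists>c. y = c *\<^sub>R x")
    case True
    then obtain c where c: "y = c *\<^sub>R x" by blast
    have "(norm (s *\<^sub>R x + t *\<^sub>R y))\<^sup>2 = s\<^sup>2 * (norm x)\<^sup>2 + 2 * s * t * (c * (norm x)\<^sup>2) + t\<^sup>2 * (norm y)\<^sup>2" for s t
    proof -
      have "s *\<^sub>R x + t *\<^sub>R y = (s + t * c) *\<^sub>R x" by (simp add: c algebra_simps)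
      then show ?thesis
        by (simp add: c power_mult_distrib) (simp add: power2_eq_square algebra_simps)
    qed
    then show thesis by (rule that)
  next
    case False
    define u where "u = x /\<^sub>R norm x"
    have u: "u \<in> V" "norm u = 1" and xu: "x = norm x *\<^sub>R u"
      using nz x by (auto simp: u_def mem_simps)
    have "y \<noteq> c *\<^sub>R u" for c using False by (auto simp: u_def)
    then obtain q \<alpha> \<beta> where q: "q \<in> V" "norm q = 1" "norm (u + q) = norm (u - q)"
      and yq: "y = \<alpha> *\<^sub>R u + \<beta> *\<^sub>R q"
      using orthonormal_complement[OF u y] by metis
    note N = norm_orthonormal[OF u q]
    \<comment> \<open>The coefficient \<open>norm x * \<alpha>\<close> is the Euclidean inner
      product of \<open>norm x *\<^sub>R u\<close> with
      \<open>\<alpha> *\<^sub>R u + \<beta> *\<^sub>R q\<close>.\<close>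
    have "(norm (s *\<^sub>R x + t *\<^sub>R y))\<^sup>2 = s\<^sup>2 * (norm x)\<^sup>2 + 2 * s * t * (norm x * \<alpha>) + t\<^sup>2 * (norm y)\<^sup>2" for s t
    proof -
      have "s *\<^sub>R x + t *\<^sub>R y = (s * norm x + t * \<alpha>) *\<^sub>R u + (t * \<beta>) *\<^sub>R q"
        by (subst xu, subst yq) (simp add: algebra_simps)
      then have "(norm (s *\<^sub>R x + t *\<^sub>R y))\<^sup>2 = (s * norm x + t * \<alpha>)\<^sup>2 + (t * \<beta>)\<^sup>2"
        by (simp only: N)
      also have "\<dots> = s\<^sup>2 * (norm x)\<^sup>2 + 2 * s * t * (norm x * \<alpha>) + t\<^sup>2 * (\<alpha>\<^sup>2 + \<beta>\<^sup>2)"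
        by (simp add: power2_eq_square algebra_simps)
      finally show ?thesis using N[of \<alpha> \<beta>] by (simp flip: yq)
    qed
    then show thesis by (rule that)
  qed
qed

section \<open>Polarization and the Hilbert space structure\<close>

definition polar :: "'a \<Rightarrow> 'a \<Rightarrow> real" where
  "polar x y = ((norm (x + y))\<^sup>2 - (norm x)\<^sup>2 - (norm y)\<^sup>2) / 2"

lemma norm_combination_polar:
  assumes "x \<in> V" "y \<in> V"
  shows "(norm (s *\<^sub>R x + t *\<^sub>R y))\<^sup>2 = s\<^sup>2 * (norm x)\<^sup>2 + 2 * s * t * polar x y + t\<^sup>2 * (norm y)\<^sup>2"
proof -
  obtain k where k: "\<And>s t. (norm (s *\<^sub>R x + t *\<^sub>R y))\<^sup>2 = s\<^sup>2 * (norm x)\<^sup>2 + 2 * s * t * k + t\<^sup>2 * (norm y)\<^sup>2"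
    using norm_quadratic[OF assms] by blast
  have "polar x y = k" using k[of 1 1] by (simp add: polar_def)
  then show ?thesis using k by simp
qed

lemma parallelogram:
  assumes "x \<in> V" "y \<in> V"
  shows "(norm (x + y))\<^sup>2 + (norm (x - y))\<^sup>2 = 2 * (norm x)\<^sup>2 + 2 * (norm y)\<^sup>2"
  using norm_combination_polar[OF assms, of 1 1] norm_combination_polar[OF assms, of 1 "-1"] by simp

lemma polar_scale_left:
  assumes "x \<in> V" "y \<in> V"
  shows "polar (r *\<^sub>R x) y = r * polar x y"
  using norm_combination_polar[OF assms, of r 1] by (simp add: polar_def power_mult_distrib)

lemma polar_add_left:
  assumes "x \<in> V" "y \<in> V" "z \<in> V"
  shows "polar (x + y) z = polar x z + polar y z"
proof -
  note [simp] = assms mem_simps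
  have "(norm (x + y + z))\<^sup>2 + (norm (x + y - z))\<^sup>2 = 2 * (norm (x + y))\<^sup>2 + 2 * (norm z)\<^sup>2"
    by (rule parallelogram) simp_all
  moreover have "(norm (x + z + y))\<^sup>2 + (norm (x + z - y))\<^sup>2 = 2 * (norm (x + z))\<^sup>2 + 2 * (norm y)\<^sup>2"
    by (rule parallelogram) simp_all
  moreover have "(norm (x + (y - z)))\<^sup>2 + (norm (x - (y - z)))\<^sup>2 = 2 * (norm x)\<^sup>2 + 2 * (norm (y - z))\<^sup>2"
    by (rule parallelogram) simp_all
  moreover have "(norm (y + z))\<^sup>2 + (norm (y - z))\<^sup>2 = 2 * (norm y)\<^sup>2 + 2 * (norm z)\<^sup>2"
    by (rule parallelogram) simp_all
  moreover have "x + z + y = x + y + z" "x + (y - z) = x + y - z" "x - (y - z) = x + z - y"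
    by simp_all
  \<comment> \<open>Adding the first two parallelogram identities and subtracting the third leaves
    \<open>norm (y - z)\<close>, which the fourth eliminates.\<close>
  ultimately have "(norm (x + y + z))\<^sup>2 = (norm (x + y))\<^sup>2 + (norm (x + z))\<^sup>2 + (norm (y + z))\<^sup>2
      - (norm x)\<^sup>2 - (norm y)\<^sup>2 - (norm z)\<^sup>2"
    by simp
  then show ?thesis unfolding polar_def by (simp add: field_simps)
qed

lemma polar_self: "polar x x = (norm x)\<^sup>2"
  by (simp add: polar_def power_mult_distrib flip: scaleR_2)

lemma polar_commute: "polar x y = polar y x"
  by (simp add: polar_def add.commute)

lemma isometric_to_real_hilbert_space:
  assumes "complete V"
  shows "isometric_to_real_hilbert_space V"
proof -
  \<comment> \<open>The Hilbert space is \<open>V\<close> itself and the isometry is the identity;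
    \<open>hdist\<close> is then the ambient metric, so completeness carries over from
    \<open>V\<close>.\<close>
  define H where "H = \<lparr>hcarrier = V, hzero = 0, hadd = (+), hscale = (*\<^sub>R), hinner = polar\<rparr>"
  have hnorm: "hnorm H x = norm x" for x
    by (simp add: hnorm_def H_def polar_self)
  have hdist: "hdist H x y = dist x y" for x y
    unfolding hdist_def hnorm by (simp add: H_def dist_norm)
  have "real_hilbert_space H"
  proof
    fix X :: "nat \<Rightarrow> 'a"
    assume X: "\<And>n. X n \<in> hcarrier H"
      and "\<forall>\<epsilon>>0. \<exists>N. \<forall>m\<ge>N. \<forall>n\<ge>N. hdist H (X m) (X n) < \<epsilon>"
    then have "Cauchy X" by (simp add: Cauchy_def hdist)
    moreover have "\<forall>n. X n \<in> V" using X by (simp add: H_def)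
    ultimately obtain l where "l \<in> V" "X \<longlonglongrightarrow> l"
      using assms unfolding complete_def by blast
    then show "\<exists>l\<in>hcarrier H. (\<lambda>n. hdist H (X n) l) \<longlonglongrightarrow> 0"
      using tendsto_dist_iff[of X l sequentially] unfolding hdist by (auto simp: H_def)
  qed (auto simp: H_def mem_simps polar_self polar_scale_left polar_add_left algebra_simps
      intro: polar_commute)
  moreover have "linear_isometry_onto id V H"
    unfolding linear_isometry_onto_def by (simp add: hnorm) (simp add: H_def)
  ultimately show ?thesis unfolding isometric_to_real_hilbert_space_def by blast
qed

end

section \<open>Congruence and types of pairs\<close>

lemma congruent_tuples_pair:
  "congruent_tuples 2 [a, b] [c, d] \<longleftrightarrow>
    norm a = norm c \<and> norm b = norm d \<and> norm (a - b) = norm (c - d)"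
proof -
  have "(\<forall>i\<le>2. P i) \<longleftrightarrow> P 0 \<and> P 1 \<and> P (2::nat)" for P
    by (auto simp: numeral_2_eq_2 le_Suc_eq)
  then show ?thesis
    by (auto simp: congruent_tuples_def norm_minus_commute)
qed

text \<open>Index \<open>n\<close> addresses the appended 0, so distances to it are norms of
  entries.\<close>

lemma congruent_tuples_iff:
  assumes "length b = n" "length c = n"
  shows "congruent_tuples n b c \<longleftrightarrow>
    (\<forall>i<n. norm (b ! i) = norm (c ! i)) \<and> (\<forall>i<n. \<forall>j<n. norm (b ! i - b ! j) = norm (c ! i - c ! j))"
  using assms by (auto simp: congruent_tuples_def nth_append le_less norm_minus_commute)

lemma (in is_banach_structure) same_type_pair_norm:
  assumes "same_type M A 2 [a, b] [c, d]"
  shows "norm (l *\<^sub>R a + m *\<^sub>R b) = norm (l *\<^sub>R c + m *\<^sub>R d)"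
proof -
  \<comment> \<open>Every tuple of scalars has its norm predicate, and this formula has no
    parameters, so it is available over any \<open>A\<close>.\<close>
  let ?\<phi> = "NormComb [of_real l, of_real m] [Var 0, Var 1] :: ('k, 'a, 'f, 'p) fm"
  have "fm_val M (assignment [a, b]) ?\<phi> = fm_val M (assignment [c, d]) ?\<phi>"
    using assms unfolding same_type_def by (elim allE[of _ ?\<phi>] impE) auto
  then show ?thesis by (simp add: lincomb_def assignment_def scal_of_real)
qed

lemma (in is_banach_structure) indiscernible_pair_rigid:
  assumes "indiscernible_subspace_over M A V"
  shows "pair_rigid_subspace V"
proof
  show V: "subspace V"
    using assms by (simp add: indiscernible_subspace_over_def real_subspace_def)
  fix a b c d l m
  assume mem: "a \<in> V" "b \<in> V" "c \<in> V" "d \<in> V"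
    and eq: "norm a = norm c" "norm b = norm d" "norm (a - b) = norm (c - d)"
  \<comment> \<open>Indiscernibility speaks only of tuples from the unit ball. Scaling by
    \<open>r\<close> moves \<open>a\<close> and \<open>b\<close> there, hence also \<open>c\<close>
    and \<open>d\<close>, which have the same norms, and it preserves congruence.\<close>
  define r where "r = inverse (1 + norm a + norm b)"
  have r: "r > 0" by (simp add: r_def add_pos_nonneg)
  have "r * norm a \<le> 1" "r * norm b \<le> 1"
    by (simp_all add: r_def divide_inverse_commute[symmetric] divide_le_eq add_pos_nonneg)
  then have "[r *\<^sub>R a, r *\<^sub>R b] \<in> tuples 2 (V \<inter> cball 0 1)" "[r *\<^sub>R c, r *\<^sub>R d] \<in> tuples 2 (V \<inter> cball 0 1)"
    using mem eq r V by (auto simp: tuples_def subspace_scale)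
  moreover have "congruent_tuples 2 [r *\<^sub>R a, r *\<^sub>R b] [r *\<^sub>R c, r *\<^sub>R d]"
    using eq by (simp add: congruent_tuples_pair flip: scaleR_diff_right)
  ultimately have "same_type M A 2 [r *\<^sub>R a, r *\<^sub>R b] [r *\<^sub>R c, r *\<^sub>R d]"
    using assms unfolding indiscernible_subspace_over_def by blast
  \<comment> \<open>Dividing the coefficients by \<open>r\<close> undoes the scaling of the
    vectors.\<close>
  from same_type_pair_norm[OF this, of "l / r" "m / r"]
  show "norm (l *\<^sub>R a + m *\<^sub>R b) = norm (l *\<^sub>R c + m *\<^sub>R d)" using r by simp
qed

lemma (in is_banach_structure) indiscernible_imp_hilbert:
  assumes "indiscernible_subspace_over M A V"
  shows "isometric_to_real_hilbert_space V"
  using pair_rigid_subspace.isometric_to_real_hilbert_space[OF indiscernible_pair_rigid[OF assms]] assms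
  by (simp add: indiscernible_subspace_over_def real_subspace_def complete_eq_closed)

section \<open>The inner product and Gram matrices\<close>

lemma
  assumes V: "subspace V" and iso: "isometric_to_real_hilbert_space V" and x: "x \<in> V"
  shows real_inner_of_self: "real_inner_of V x x = (norm x)\<^sup>2"
    and norm_diff_real_inner_of:
      "y \<in> V \<Longrightarrow> (norm (x - y))\<^sup>2 = (norm x)\<^sup>2 + (norm y)\<^sup>2 - 2 * real_inner_of V x y"
proof -
  obtain H :: "'a hilbert_data" and f where H: "real_hilbert_space H" and f: "linear_isometry_onto f V H"
    using iso unfolding isometric_to_real_hilbert_space_def by blast
  interpret real_hilbert_space H by (fact H)
  \<comment> \<open>This replaces the definite description by the inner product of one fixed
    \<open>H\<close>, from which bilinearity and symmetry transfer.\<close>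
  note inner_eq = real_inner_of_eq[OF V H f]
  have mem: "f v \<in> hcarrier H" if "v \<in> V" for v
    using f that by (auto simp: linear_isometry_onto_def bij_betw_def)
  have self: "real_inner_of V v v = (norm v)\<^sup>2" if "v \<in> V" for v
  proof -
    have "norm v = sqrt (hinner H (f v) (f v))"
      using f that by (simp add: linear_isometry_onto_def hnorm_def)
    then show ?thesis using inner_nonneg[OF mem[OF that]] that by (simp add: inner_eq)
  qed
  then show "real_inner_of V x x = (norm x)\<^sup>2" using x by blast
  have commute: "real_inner_of V v w = real_inner_of V w v" if "v \<in> V" "w \<in> V" for v w
    using that inner_commute mem by (simp add: inner_eq)
  have add: "real_inner_of V (u + v) w = real_inner_of V u w + real_inner_of V v w"
    if "u \<in> V" "v \<in> V" "w \<in> V" for u v w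
    using that f mem inner_add_left V
    by (simp add: inner_eq subspace_add linear_isometry_onto_def)
  have scale: "real_inner_of V (r *\<^sub>R v) w = r * real_inner_of V v w"
    if "v \<in> V" "w \<in> V" for r v w
    using that f mem inner_scale_left V
    by (simp add: inner_eq subspace_scale linear_isometry_onto_def)
  assume y: "y \<in> V"
  have diff: "real_inner_of V (x - y) w = real_inner_of V x w - real_inner_of V y w" if "w \<in> V" for w
    using add[OF x subspace_neg[OF V y] that] scale[OF y that, of "- 1"] by simp
  show "(norm (x - y))\<^sup>2 = (norm x)\<^sup>2 + (norm y)\<^sup>2 - 2 * real_inner_of V x y"
    using self[OF x] self[OF y] self[OF subspace_diff[OF V x y]] diff[OF subspace_diff[OF V x y]]
      diff[OF x] diff[OF y] commute[OF x y] commute[OF x subspace_diff[OF V x y]]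
      commute[OF y subspace_diff[OF V x y]] by simp
qed

text \<open>The diagonal of the Gram matrix consists of the squared norms; once these agree, the law
  of cosines exchanges distances and inner products.\<close>

lemma congruent_tuples_iff_real_inner:
  assumes V: "subspace V" and iso: "isometric_to_real_hilbert_space V"
    and b: "b \<in> tuples n V" and c: "c \<in> tuples n V"
  shows "congruent_tuples n b c \<longleftrightarrow>
    (\<forall>i<n. \<forall>j<n. real_inner_of V (b ! i) (b ! j) = real_inner_of V (c ! i) (c ! j))"
    (is "_ \<longleftrightarrow> ?gram")
proof -
  have len: "length b = n" "length c = n" and mem: "\<And>i. i < n \<Longrightarrow> b ! i \<in> V" "\<And>i. i < n \<Longrightarrow> c ! i \<in> V"
    using b c by (auto simp: tuples_def)
  note self = real_inner_of_self[OF V iso] and diff = norm_diff_real_inner_of[OF V iso]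
  show ?thesis
  proof
    assume cong: "congruent_tuples n b c"
    show ?gram
    proof (intro allI impI)
      fix i j assume ij: "i < n" "j < n"
      show "real_inner_of V (b ! i) (b ! j) = real_inner_of V (c ! i) (c ! j)"
        using cong ij diff[of "b ! i" "b ! j"] diff[of "c ! i" "c ! j"] mem
        by (simp add: congruent_tuples_iff[OF len])
    qed
  next
    assume gram: ?gram
    have norm: "norm (b ! i) = norm (c ! i)" if "i < n" for i
      using gram that self[of "b ! i"] self[of "c ! i"] mem by simp
    have "norm (b ! i - b ! j) = norm (c ! i - c ! j)" if "i < n" "j < n" for i j
    proof -
      have "(norm (b ! i - b ! j))\<^sup>2 = (norm (c ! i - c ! j))\<^sup>2"
        using gram that norm diff mem by simp
      then show ?thesis by simp
    qed
    then show "congruent_tuples n b c" using norm by (simp add: congruent_tuples_iff[OF len])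
  qed
qed

theorem proposition2p2:
  fixes M :: "('k::real_or_complex, 'a::banach, 'f, 'p) banach_structure"
  assumes "is_banach_structure M"
  shows "(\<forall>V. indiscernible_subspace M V \<longrightarrow> isometric_to_real_hilbert_space V) \<and>
    (\<forall>A V. A \<subseteq> cball 0 1 \<longrightarrow> real_subspace V \<longrightarrow>
       (indiscernible_subspace_over M A V \<longleftrightarrow>
          isometric_to_real_hilbert_space V \<and>
          (\<forall>n. \<forall>b\<in>tuples n (V \<inter> cball 0 1). \<forall>c\<in>tuples n (V \<inter> cball 0 1).
             same_type M A n b c \<longleftrightarrow>
             (\<forall>i<n. \<forall>j<n. real_inner_of V (b ! i) (b ! j) = real_inner_of V (c ! i) (c ! j)))))"
proof -
  interpret is_banach_structure M by (fact assms)
  have mono: "b \<in> tuples n V" if "b \<in> tuples n (V \<inter> cball 0 1)" for b n and V :: "'a set"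
    using that by (auto simp: tuples_def)
  show ?thesis
  proof (intro conjI allI impI)
    fix V
    assume "indiscernible_subspace M V"
    then show "isometric_to_real_hilbert_space V"
      using indiscernible_imp_hilbert by (auto simp: indiscernible_subspace_def)
  next
    fix A V :: "'a set"
    assume V: "real_subspace V"
    show "indiscernible_subspace_over M A V \<longleftrightarrow>
      isometric_to_real_hilbert_space V \<and>
      (\<forall>n. \<forall>b\<in>tuples n (V \<inter> cball 0 1). \<forall>c\<in>tuples n (V \<inter> cball 0 1).
         same_type M A n b c \<longleftrightarrow>
         (\<forall>i<n. \<forall>j<n. real_inner_of V (b ! i) (b ! j) = real_inner_of V (c ! i) (c ! j)))"
    \<comment> \<open>For a Hilbert space \<open>V\<close> the two sides differ only by congruence
      versus equal Gram matrices; for any other \<open>V\<close> both sides are false.\<close>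
    proof (cases "isometric_to_real_hilbert_space V")
      case True
      have "congruent_tuples n b c \<longleftrightarrow>
          (\<forall>i<n. \<forall>j<n. real_inner_of V (b ! i) (b ! j) = real_inner_of V (c ! i) (c ! j))"
        if "b \<in> tuples n (V \<inter> cball 0 1)" "c \<in> tuples n (V \<inter> cball 0 1)" for n b c
        using V True that mono by (intro congruent_tuples_iff_real_inner) (auto simp: real_subspace_def)
      then show ?thesis using V True by (simp add: indiscernible_subspace_over_def)
    next
      case False
      then show ?thesis using indiscernible_imp_hilbert by blast
    qed
  qed
qed

end
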